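(* Let $n,d\ge 1$ be integers, let $\mathcal{B}=(l_1,u_1,\dots,l_d,u_d)$ be a bounding family, and let $\mathcal{D}=\prod_{r=1}^d\mathcal{D}_r$ be a product distribution on $[n]^d$. For every $\varepsilon>0$ there is a tester for the property $\mathcal{P}(\mathcal{B})$ with respect to $\mathcal{D}$ (for functions $f:[n]^d\to\mathbb{R}$) with proximity parameter $\varepsilon$ that makes $100\,\varepsilon^{-1}\Delta^*(\mathcal{D})$ queries.
   Context: $[k]=\{1,\dots,k\}$ and $\mathbf{e}_r$ is the $r$-th unit vector. A bounding family is a tuple of $2d$ functions $l_1,u_1,\dots,l_d,u_d:[n-1]\to\mathbb{R}$ with $l_r(y)<u_r(y)$ for all $r\in[d]$, $y\in[n-1]$. The property $\mathcal{P}(\mathcal{B})$ is the set of $f:[n]^d\to\mathbb{R}$ such that $l_r(x_r)\le f(x+\mathbf{e}_r)-f(x)\le u_r(x_r)$ for all $r\in[d]$ and all $x\in[n]^d$ with $x_r<n$. For a distribution $\mathcal{D}$ on $[n]^d$, $\mathrm{dist}_{\mathcal{D}}(f,g)=\Pr_{x\sim\mathcal{D}}[f(x)\ne g(x)]$ and $\mathrm{dist}_{\mathcal{D}}(f,\mathcal{P})=\inf_{g\in\mathcal{P}}\mathrm{dist}_{\mathcal{D}}(f,g)$. A tester for $\mathcal{P}$ w.r.t. $\mathcal{D}$ with proximity parameter $\varepsilon$ knows $\mathcal{D}$, has query access to $f$, accepts with probability $>2/3$ if $f\in\mathcal{P}$, and rejects with probability $>2/3$ if $\mathrm{dist}_{\mathcal{D}}(f,\mathcal{P})>\varepsilon$.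 For a binary search tree (BST) $T$ on the totally ordered universe $[n]$, the depth of a node is the number of edges from it to the root; for a distribution $\mathcal{D}_r$ on $[n]$, $\Delta^*(\mathcal{D}_r)$ is the minimum over all BSTs $T$ on $[n]$ of $\mathbb{E}_{v\sim\mathcal{D}_r}[\mathrm{depth}_T(v)]$, and for a product distribution $\Delta^*(\mathcal{D})=\sum_{r=1}^d\Delta^*(\mathcal{D}_r)$. *)

theory Defs
  imports "HOL-Probability.Probability" "HOL-Library.Tree"
begin

definition grid :: "nat \<Rightarrow> nat \<Rightarrow> (nat \<Rightarrow> nat) set" where
  "grid n d = PiE {1..d} (\<lambda>_. {1..n})"

definition bounding_family :: "nat \<Rightarrow> nat \<Rightarrow> (nat \<Rightarrow> nat \<Rightarrow> real) \<Rightarrow> (nat \<Rightarrow> nat \<Rightarrow> real) \<Rightarrow> bool" where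
  "bounding_family n d l u \<longleftrightarrow> (\<forall>r\<in>{1..d}. \<forall>y\<in>{1..n-1}. l r y < u r y)"

definition prop_B :: "nat \<Rightarrow> nat \<Rightarrow> (nat \<Rightarrow> nat \<Rightarrow> real) \<Rightarrow> (nat \<Rightarrow> nat \<Rightarrow> real)
    \<Rightarrow> ((nat \<Rightarrow> nat) \<Rightarrow> real) set" where
  "prop_B n d l u = {f. \<forall>r\<in>{1..d}. \<forall>x\<in>grid n d. x r < n \<longrightarrow>
      l r (x r) \<le> f (x(r := x r + 1)) - f x \<and> f (x(r := x r + 1)) - f x \<le> u r (x r)}"

definition prod_dist :: "nat \<Rightarrow> (nat \<Rightarrow> nat pmf) \<Rightarrow> (nat \<Rightarrow> nat) pmf" where
  "prod_dist d Dr = Pi_pmf {1..d} undefined Dr"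

definition distD :: "(nat \<Rightarrow> nat) pmf \<Rightarrow> ((nat \<Rightarrow> nat) \<Rightarrow> real) \<Rightarrow> ((nat \<Rightarrow> nat) \<Rightarrow> real) \<Rightarrow> real" where
  "distD D f g = measure_pmf.prob D {x. f x \<noteq> g x}"

definition distD_set :: "(nat \<Rightarrow> nat) pmf \<Rightarrow> ((nat \<Rightarrow> nat) \<Rightarrow> real) \<Rightarrow> ((nat \<Rightarrow> nat) \<Rightarrow> real) set \<Rightarrow> real" where
  "distD_set D f P = (INF g\<in>P. distD D f g)"

fun bst_depth :: "nat tree \<Rightarrow> nat \<Rightarrow> nat" where
  "bst_depth Leaf v = 0"
| "bst_depth (Node l a r) v =
     (if v = a then 0 else if v < a then Suc (bst_depth l v) else Suc (bst_depth r v))"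

definition bsts_on :: "nat \<Rightarrow> nat tree set" where
  "bsts_on n = {t. bst t \<and> set_tree t = {1..n}}"

definition Delta_star_1 :: "nat \<Rightarrow> nat pmf \<Rightarrow> real" where
  "Delta_star_1 n Dr = (INF t\<in>bsts_on n. measure_pmf.expectation Dr (\<lambda>v. real (bst_depth t v)))"

definition Delta_star :: "nat \<Rightarrow> nat \<Rightarrow> (nat \<Rightarrow> nat pmf) \<Rightarrow> real" where
  "Delta_star n d Dr = (\<Sum>r=1..d. Delta_star_1 n (Dr r))"

text \<open>Deterministic adaptive query algorithm: (Q, out). Q maps the list of
 answers received so far to the next query point; out maps the final list of
 answers to accept (True) / reject (False).\<close>
type_synonym query_alg = "(real list \<Rightarrow> (nat \<Rightarrow> nat)) \<times> (real list \<Rightarrow> bool)"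

fun answers :: "(real list \<Rightarrow> (nat \<Rightarrow> nat)) \<Rightarrow> ((nat \<Rightarrow> nat) \<Rightarrow> real) \<Rightarrow> nat \<Rightarrow> real list" where
  "answers Q f 0 = []"
| "answers Q f (Suc k) = (let as = answers Q f k in as @ [f (Q as)])"

definition run_alg :: "query_alg \<Rightarrow> nat \<Rightarrow> ((nat \<Rightarrow> nat) \<Rightarrow> real) \<Rightarrow> bool" where
  "run_alg A q f = snd A (answers (fst A) f q)"

text \<open>A randomized tester making q queries: a distribution over deterministic
 q-query algorithms, all of whose queries lie in the domain [n]^d.\<close>
definition accept_prob :: "query_alg pmf \<Rightarrow> nat \<Rightarrow> ((nat \<Rightarrow> nat) \<Rightarrow> real) \<Rightarrow> real" where
  "accept_prob T q f = measure_pmf.prob T {A. run_alg A q f}"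

definition is_tester :: "nat \<Rightarrow> nat \<Rightarrow> ((nat \<Rightarrow> nat) \<Rightarrow> real) set \<Rightarrow> (nat \<Rightarrow> nat) pmf \<Rightarrow> real
    \<Rightarrow> query_alg pmf \<Rightarrow> nat \<Rightarrow> bool" where
  "is_tester n d P D \<epsilon> T q \<longleftrightarrow>
     (\<forall>A\<in>set_pmf T. \<forall>as. fst A as \<in> grid n d) \<and>
     (\<forall>f. f \<in> P \<longrightarrow> accept_prob T q f > 2/3) \<and>
     (\<forall>f. distD_set D f P > \<epsilon> \<longrightarrow> 1 - accept_prob T q f > 2/3)"

end

theory Submission
  imports Defs
begin

text \<open>
  A test picks \<open>x\<close> from the distribution, a dimension \<open>r\<close> and a proper ancestor of \<open>x r\<close> in an optimal
  search tree for dimension \<open>r\<close>, and checks the bounds between the two points. Two values on a line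
  that are both consistent with their common ancestor between them are consistent with each other, so
  deleting the points that fail against some ancestor and extending makes \<open>f\<close> good along dimension \<open>r\<close>.
  It remains to bound the distance to the property by the total mass of these one-dimensional repairs.

  For this, let \<open>V t f\<close> be the least weighted sum of \<open>max (\<bar>f x - g x\<bar> - t) 0\<close> over \<open>g\<close> in the class
  considered. For small \<open>t > 0\<close> the difference \<open>V 0 f - V t f\<close> is at least \<open>t\<close> times the Hamming
  distance. Uncrossing minimisers shows that this difference changes by at most \<open>3 * t\<close> times the
  weight of the points where \<open>f\<close> is modified. Moreover, if \<open>f\<close> is already good along dimension \<open>r\<close>,
  imposing the constraints of dimension \<open>r\<close> on \<open>g\<close> does not change \<open>V\<close>: by convexity, the minimisers on
  the slices can be chosen to inherit the bounds. Hence adding the dimensions one after the other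
  costs at most \<open>6 * t\<close> times the repair mass each.
\<close>

section \<open>Lattices of functions closed under shifts\<close>

definition hinge :: "real \<Rightarrow> real \<Rightarrow> real" where
  "hinge t z = max (\<bar>z\<bar> - t) 0"

lemma hinge_zero: "hinge 0 z = \<bar>z\<bar>"
  by (simp add: hinge_def)

lemma hinge_nonneg: "0 \<le> hinge t z"
  by (simp add: hinge_def)

lemma hinge_ge: "z - t \<le> hinge t z" "- z - t \<le> hinge t z"
  unfolding hinge_def by linarith+

lemma hinge_cases:
  "hinge t z = z - t \<or> hinge t z = - z - t \<or> hinge t z = 0"
  unfolding hinge_def by linarith

text \<open>Only \<open>g < h\<close> needs an argument. Then \<open>F' - h\<close> and
  \<open>F - g\<close> both lie between \<open>F - h\<close> and \<open>F' - g\<close> and have the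
  same sum, so convexity of \<open>hinge t\<close> gives the inequality.\<close>

lemma hinge_monge:
  assumes "F \<le> F'"
  shows "hinge t (F' - max g h) + hinge t (F - min g h) \<le> hinge t (F' - g) + hinge t (F - h)"
proof (cases "h \<le> g")
  case True
  then show ?thesis by (simp add: max_def min_def)
next
  case False
  then have e: "max g h = h" "min g h = g" by auto
  note bounds = hinge_ge[of "F' - g" t] hinge_ge[of "F - h" t]
    hinge_nonneg[of t "F' - g"] hinge_nonneg[of t "F - h"]
  show ?thesis unfolding e
    using hinge_cases[of t "F' - h"] hinge_cases[of t "F - g"] bounds False assms
    by (elim disjE) linarith+
qed

text \<open>The new pair must be given by one formula that does not depend on whether
  \<open>F = F'\<close>, since it is later applied to whole functions. Swapping \<open>a\<close> and
  \<open>b\<close> is free where \<open>F = F'\<close> but uncontrolled elsewhere; plain min and max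
  are safe for \<open>F <= F'\<close> but can lose where \<open>F = F'\<close>. The shifts by
  \<open>t\<close> interpolate between the two.\<close>

lemma hinge_exchange:
  assumes "0 \<le> t" "F \<le> F'"
  shows "hinge 0 (F - min b (a + t)) + hinge t (F' - max a (b - t))
      \<le> hinge t (F - a) + hinge 0 (F' - b) + (if F = F' then 0 else 3 * t)"
proof (cases "F = F'")
  case True
  show ?thesis
  proof (cases "b \<le> a + t")
    case True
    then have "min b (a + t) = b" "max a (b - t) = a" by auto
    then show ?thesis using \<open>F = F'\<close> by simp
  next
    case False
    then have "min b (a + t) = a + t" "max a (b - t) = b - t" using assms(1) by auto
    with False assms(1) show ?thesis unfolding \<open>F = F'\<close> hinge_def
      by (simp add: max_def abs_if)
  qed
next
  case False
  \<comment> \<open>The loss \<open>3 * t\<close> is one \<open>t\<close> for each of the two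
    shifted competitors and one for replacing \<open>hinge t (F - a)\<close> by the absolute
    value.\<close>
  have "\<bar>F - min b a\<bar> + \<bar>F' - max a b\<bar> \<le> \<bar>F - a\<bar> + \<bar>F' - b\<bar>"
    using hinge_monge[OF assms(2), of 0 b a] by (simp add: hinge_def max.commute)
  moreover have "\<bar>F - min b (a + t)\<bar> \<le> \<bar>F - min b a\<bar> + t" using assms(1) by linarith
  moreover have "hinge t (F' - max a (b - t)) \<le> \<bar>F' - max a b\<bar> + t"
    using assms(1) unfolding hinge_def by linarith
  moreover have "\<bar>F - a\<bar> - t \<le> hinge t (F - a)" unfolding hinge_def by linarith
  ultimately show ?thesis using False by (simp add: hinge_zero)
qed

lemma hinge_exchange':
  assumes "0 \<le> t" "F' \<le> F"
  shows "hinge 0 (F - max b (a - t)) + hinge t (F' - min a (b + t))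
      \<le> hinge t (F - a) + hinge 0 (F' - b) + (if F = F' then 0 else 3 * t)"
proof -
  have *: "hinge s (- z) = hinge s z" for s z by (simp add: hinge_def)
  have e: "- F - min (- b) (- a + t) = - (F - max b (a - t))"
    "- F' - max (- a) (- b - t) = - (F' - min a (b + t))"
    "- F - - a = - (F - a)" "- F' - - b = - (F' - b)" "(- F = - F') = (F = F')"
    by (auto simp: min_def max_def)
  show ?thesis using hinge_exchange[of t "-F" "-F'" "-b" "-a"] assms unfolding e * by simp
qed

text \<open>Min and max serve for uncrossing, shifts for clamping and for the exchange above.
  Closedness, in the product topology, gives minimisers; \<open>C_cong\<close> makes the class
  insensitive to values off the finite set \<open>X\<close>.\<close>

locale shift_lattice =
  fixes X :: "'a set" and w :: "'a \<Rightarrow> real" and C :: "('a \<Rightarrow> real) set"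
  assumes fin: "finite X"
    and w_nonneg: "\<And>x. x \<in> X \<Longrightarrow> 0 \<le> w x"
    and nonempty: "C \<noteq> {}"
    and C_min: "g \<in> C \<Longrightarrow> h \<in> C \<Longrightarrow> (\<lambda>x. min (g x) (h x)) \<in> C"
    and C_max: "g \<in> C \<Longrightarrow> h \<in> C \<Longrightarrow> (\<lambda>x. max (g x) (h x)) \<in> C"
    and C_shift: "g \<in> C \<Longrightarrow> (\<lambda>x. g x + c) \<in> C"
    and C_closed: "closed C"
    and C_cong: "g \<in> C \<Longrightarrow> (\<And>x. x \<in> X \<Longrightarrow> h x = g x) \<Longrightarrow> h \<in> C"
begin

section \<open>Optimal approximation from the class, and the gain\<close>

definition cost :: "real \<Rightarrow> ('a \<Rightarrow> real) \<Rightarrow> ('a \<Rightarrow> real) \<Rightarrow> real" where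
  "cost t f g = (\<Sum>x\<in>X. w x * hinge t (f x - g x))"

definition val :: "real \<Rightarrow> ('a \<Rightarrow> real) \<Rightarrow> real" where
  "val t f = (INF g\<in>C. cost t f g)"

definition gain :: "real \<Rightarrow> ('a \<Rightarrow> real) \<Rightarrow> real" where
  "gain t f = val 0 f - val t f"

lemma cost_nonneg: "0 \<le> cost t f g"
  unfolding cost_def by (intro sum_nonneg mult_nonneg_nonneg w_nonneg hinge_nonneg)

lemma val_le: "g \<in> C \<Longrightarrow> val t f \<le> cost t f g"
  unfolding val_def by (rule cINF_lower) (auto intro: bdd_belowI[of _ 0] cost_nonneg)

lemma val_greatest: "(\<And>g. g \<in> C \<Longrightarrow> v \<le> cost t f g) \<Longrightarrow> v \<le> val t f"
  unfolding val_def using nonempty by (rule cINF_greatest)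

lemma cost_mono:
  "(\<And>x. x \<in> X \<Longrightarrow> hinge t (f x - g x) \<le> hinge t (f x - h x)) \<Longrightarrow> cost t f g \<le> cost t f h"
  unfolding cost_def by (intro sum_mono mult_left_mono w_nonneg)

lemma cost_shift: "cost t (\<lambda>x. f x + c) (\<lambda>x. g x + c) = cost t f g"
  unfolding cost_def by simp

text \<open>Clamping a competitor between two shifts of a fixed element of \<open>C\<close> that enclose \<open>f\<close> does not
  increase its cost, so the minimisation takes place on a compact set.\<close>

lemma val_attained:
  assumes "0 \<le> t"
  obtains g where "g \<in> C" "cost t f g = val t f"
proof -
  obtain e where e: "e \<in> C" using nonempty by auto
  define K where "K = (\<Sum>x\<in>X. \<bar>f x - e x\<bar>)"
  have K: "\<bar>f x - e x\<bar> \<le> K" if "x \<in> X" for x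
    unfolding K_def using member_le_sum[OF that, of "\<lambda>x. \<bar>f x - e x\<bar>"] fin by simp
  have K0: "0 \<le> K" unfolding K_def by (simp add: sum_nonneg)
  \<comment> \<open>Coordinates outside \<open>X\<close> are frozen at \<open>e\<close>, so that
    \<open>B\<close> is a product of compact sets and Tychonoff applies.\<close>
  define B where "B = (\<Pi>\<^sub>E x\<in>UNIV. if x \<in> X then {e x - K..e x + K} else {e x})"
  have "compactin (product_topology (\<lambda>_. euclidean) UNIV) B"
    unfolding B_def by (subst compactin_PiE) auto
  then have "compact B" by (simp add: euclidean_product_topology)
  then have comp: "compact (C \<inter> B)" by (rule closed_Int_compact[OF C_closed])
  have "e \<in> C \<inter> B" using e K0 by (auto simp: B_def)
  moreover have "continuous_on (C \<inter> B) (cost t f)"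
    unfolding cost_def hinge_def by (intro continuous_intros
        continuous_on_subset[OF continuous_on_product_coordinates] subset_UNIV)
  ultimately obtain g where g: "g \<in> C \<inter> B" "\<And>h. h \<in> C \<inter> B \<Longrightarrow> cost t f g \<le> cost t f h"
    using continuous_attains_inf[OF comp] by blast
  have "cost t f g \<le> cost t f h" if h: "h \<in> C" for h
  proof -
    define h' where "h' x = max (min (h x) (e x + K)) (e x + - K)" for x
    define h'' where "h'' x = (if x \<in> X then h' x else e x)" for x
    have h': "h' \<in> C" unfolding h'_def by (intro C_max C_min h C_shift e)
    have "h'' \<in> C" by (rule C_cong[OF h']) (simp add: h''_def)
    moreover have "h'' \<in> B" using K0 by (auto simp: B_def h''_def h'_def)
    ultimately have "cost t f g \<le> cost t f h''" using g(2) by blast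
    also have "\<dots> \<le> cost t f h"
    proof (rule cost_mono)
      fix x assume "x \<in> X"
      have "\<bar>f x - h'' x\<bar> \<le> \<bar>f x - h x\<bar>"
        using K[OF \<open>x \<in> X\<close>] K0 \<open>x \<in> X\<close> unfolding h''_def h'_def by (simp only: if_True)
      then show "hinge t (f x - h'' x) \<le> hinge t (f x - h x)"
        unfolding hinge_def by linarith
    qed
    finally show ?thesis .
  qed
  then have "cost t f g \<le> val t f" by (rule val_greatest)
  with val_le[of g t f] g(1) that show ?thesis by force
qed

text \<open>Rearranged, the conclusion bounds \<open>val 0 f + val t f'\<close> by
  \<open>val t f + val 0 f'\<close> plus the error. So it suffices to turn optimal solutions of the
  two problems on the right into competitors for the two on the left, pointwise.\<close>

lemma gain_exchange:
  assumes t: "0 \<le> t"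
    and step: "\<And>g g'. g \<in> C \<Longrightarrow> g' \<in> C \<Longrightarrow> \<exists>h\<in>C. \<exists>h'\<in>C. \<forall>x\<in>X.
      hinge 0 (f x - h x) + hinge t (f' x - h' x)
        \<le> hinge t (f x - g x) + hinge 0 (f' x - g' x) + (if f x = f' x then 0 else 3 * t)"
  shows "gain t f \<le> gain t f' + 3 * t * sum w {x \<in> X. f x \<noteq> f' x}"
proof -
  obtain g where g: "g \<in> C" "cost t f g = val t f" using val_attained[OF t] by blast
  obtain g' where g': "g' \<in> C" "cost 0 f' g' = val 0 f'" using val_attained[of 0] by auto
  obtain h h' where h: "h \<in> C" "h' \<in> C" and le: "\<forall>x\<in>X.
      hinge 0 (f x - h x) + hinge t (f' x - h' x)
        \<le> hinge t (f x - g x) + hinge 0 (f' x - g' x) + (if f x = f' x then 0 else 3 * t)"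
    using step[OF g(1) g'(1)] by blast
  have "val 0 f + val t f' \<le> cost 0 f h + cost t f' h'"
    using val_le h by (intro add_mono) auto
  also have "\<dots> = (\<Sum>x\<in>X. w x * (hinge 0 (f x - h x) + hinge t (f' x - h' x)))"
    unfolding cost_def by (simp add: algebra_simps sum.distrib)
  also have "\<dots> \<le> (\<Sum>x\<in>X. w x * (hinge t (f x - g x) + hinge 0 (f' x - g' x)
      + (if f x = f' x then 0 else 3 * t)))"
    using le by (intro sum_mono mult_left_mono w_nonneg) auto
  also have "\<dots> = cost t f g + cost 0 f' g' + (\<Sum>x\<in>X. if f x \<noteq> f' x then 3 * t * w x else 0)"
    unfolding cost_def sum.distrib[symmetric] by (intro sum.cong) (auto simp: algebra_simps)
  also have "(\<Sum>x\<in>X. if f x \<noteq> f' x then 3 * t * w x else 0) = 3 * t * sum w {x \<in> X. f x \<noteq> f' x}"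
    using fin by (subst sum.inter_filter[symmetric]) (auto simp: sum_distrib_left)
  finally show ?thesis unfolding gain_def g g' by simp
qed

lemma gain_le_above:
  assumes t: "0 \<le> t" and le: "\<And>x. x \<in> X \<Longrightarrow> f x \<le> f' x"
  shows "gain t f \<le> gain t f' + 3 * t * sum w {x \<in> X. f x \<noteq> f' x}"
proof (rule gain_exchange[OF t])
  fix g g' assume "g \<in> C" "g' \<in> C"
  then have C: "(\<lambda>x. min (g' x) (g x + t)) \<in> C" "(\<lambda>x. max (g x) (g' x + - t)) \<in> C"
    by (auto intro: C_min C_max C_shift simp del: add_uminus_conv_diff)
  show "\<exists>h\<in>C. \<exists>h'\<in>C. \<forall>x\<in>X.
      hinge 0 (f x - h x) + hinge t (f' x - h' x)
        \<le> hinge t (f x - g x) + hinge 0 (f' x - g' x) + (if f x = f' x then 0 else 3 * t)"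
    by (rule bexI[OF _ C(1)], rule bexI[OF _ C(2)]) (use hinge_exchange[OF t le] in simp)
qed

lemma gain_le_below:
  assumes t: "0 \<le> t" and le: "\<And>x. x \<in> X \<Longrightarrow> f' x \<le> f x"
  shows "gain t f \<le> gain t f' + 3 * t * sum w {x \<in> X. f x \<noteq> f' x}"
proof (rule gain_exchange[OF t])
  fix g g' assume "g \<in> C" "g' \<in> C"
  then have C: "(\<lambda>x. max (g' x) (g x + - t)) \<in> C" "(\<lambda>x. min (g x) (g' x + t)) \<in> C"
    by (auto intro: C_min C_max C_shift simp del: add_uminus_conv_diff)
  show "\<exists>h\<in>C. \<exists>h'\<in>C. \<forall>x\<in>X.
      hinge 0 (f x - h x) + hinge t (f' x - h' x)
        \<le> hinge t (f x - g x) + hinge 0 (f' x - g' x) + (if f x = f' x then 0 else 3 * t)"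
    by (rule bexI[OF _ C(1)], rule bexI[OF _ C(2)]) (use hinge_exchange'[OF t le] in simp)
qed

text \<open>The path goes through the pointwise maximum. The points changed in the first step
  (\<open>f < f'\<close>) and in the second (\<open>f' < f\<close>) are disjoint, so the constant
  remains 3.\<close>

lemma gain_stable:
  assumes t: "0 \<le> t"
  shows "gain t f \<le> gain t f' + 3 * t * sum w {x \<in> X. f x \<noteq> f' x}"
proof -
  define h where "h x = max (f x) (f' x)" for x
  have "gain t f \<le> gain t h + 3 * t * sum w {x \<in> X. f x \<noteq> h x}"
    by (rule gain_le_above[OF t]) (simp add: h_def)
  moreover have "gain t h \<le> gain t f' + 3 * t * sum w {x \<in> X. h x \<noteq> f' x}"
    by (rule gain_le_below[OF t]) (simp add: h_def)
  moreover have "sum w {x \<in> X. f x \<noteq> h x} + sum w {x \<in> X. h x \<noteq> f' x} = sum w {x \<in> X. f x \<noteq> f' x}"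
  proof (subst sum.union_disjoint[symmetric])
    show "sum w ({x \<in> X. f x \<noteq> h x} \<union> {x \<in> X. h x \<noteq> f' x}) = sum w {x \<in> X. f x \<noteq> f' x}"
      by (rule arg_cong[where f="sum w"]) (auto simp: h_def max_def)
  qed (use fin in \<open>auto simp: h_def max_def split: if_splits\<close>)
  ultimately show ?thesis by (smt (verit) distrib_left)
qed

text \<open>With \<open>t\<close> at most the smallest nonzero deviation from an L1-minimiser
  \<open>g\<close>, raising the threshold from 0 to \<open>t\<close> saves exactly \<open>t\<close>
  at every point where \<open>f\<close> and \<open>g\<close> differ.\<close>

lemma ex_gain_ge:
  obtains g t where "g \<in> C" "0 < t" "t * sum w {x \<in> X. f x \<noteq> g x} \<le> gain t f"
proof -
  obtain g where g: "g \<in> C" "cost 0 f g = val 0 f" using val_attained[of 0] by auto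
  \<comment> \<open>The inserted 1 keeps the minimum defined when \<open>f\<close> and
    \<open>g\<close> agree on \<open>X\<close>.\<close>
  define t where "t = Min (insert 1 ((\<lambda>x. \<bar>f x - g x\<bar>) ` {x \<in> X. f x \<noteq> g x}))"
  have t: "0 < t" unfolding t_def using fin by (subst Min_gr_iff) auto
  have tle: "t \<le> \<bar>f x - g x\<bar>" if "x \<in> X" "f x \<noteq> g x" for x
    unfolding t_def using fin that by (intro Min_le) auto
  have "t * sum w {x \<in> X. f x \<noteq> g x} = (\<Sum>x\<in>X. if f x \<noteq> g x then w x * t else 0)"
    using fin by (subst sum.inter_filter[symmetric]) (auto simp: sum_distrib_left mult.commute)
  also have "\<dots> \<le> (\<Sum>x\<in>X. w x * hinge 0 (f x - g x) - w x * hinge t (f x - g x))"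
  proof (rule sum_mono)
    fix x assume x: "x \<in> X"
    show "(if f x \<noteq> g x then w x * t else 0)
        \<le> w x * hinge 0 (f x - g x) - w x * hinge t (f x - g x)"
    proof (cases "f x = g x")
      case False
      then have "hinge 0 (f x - g x) = hinge t (f x - g x) + t"
        using tle[OF x] by (simp add: hinge_def)
      then show ?thesis using False by (simp add: algebra_simps)
    qed (use t in \<open>simp add: hinge_def\<close>)
  qed
  also have "\<dots> = cost 0 f g - cost t f g" unfolding cost_def by (simp add: sum_subtractf)
  also have "\<dots> \<le> gain t f" unfolding gain_def g using val_le[OF g(1), of t f] by simp
  finally show ?thesis using that g t by blast
qed

text \<open>Uncrossing: the maximum competes for \<open>F'\<close>, the minimum for
  \<open>F\<close>, and together they cost no more than two optimal solutions. Hence both are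
  optimal.\<close>

lemma optimal_max:
  assumes le: "\<And>x. x \<in> X \<Longrightarrow> F x \<le> F' x"
    and g: "g \<in> C" "cost t F' g = val t F'" and h: "h \<in> C" "cost t F h = val t F"
  shows "cost t F' (\<lambda>x. max (g x) (h x)) = val t F'"
proof -
  have "cost t F' (\<lambda>x. max (g x) (h x)) + cost t F (\<lambda>x. min (g x) (h x)) \<le> cost t F' g + cost t F h"
    unfolding cost_def sum.distrib[symmetric] distrib_left[symmetric]
    by (intro sum_mono mult_left_mono w_nonneg hinge_monge le)
  moreover have "val t F \<le> cost t F (\<lambda>x. min (g x) (h x))"
    "val t F' \<le> cost t F' (\<lambda>x. max (g x) (h x))"
    by (auto intro: val_le C_min C_max g h)
  ultimately show ?thesis using g h by simp
qed

lemma optimal_min: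
  assumes le: "\<And>x. x \<in> X \<Longrightarrow> F' x \<le> F x"
    and g: "g \<in> C" "cost t F' g = val t F'" and h: "h \<in> C" "cost t F h = val t F"
  shows "cost t F' (\<lambda>x. min (g x) (h x)) = val t F'"
proof -
  have "cost t F (\<lambda>x. max (h x) (g x)) + cost t F' (\<lambda>x. min (h x) (g x)) \<le> cost t F h + cost t F' g"
    unfolding cost_def sum.distrib[symmetric] distrib_left[symmetric]
    by (intro sum_mono mult_left_mono w_nonneg hinge_monge le)
  moreover have "val t F \<le> cost t F (\<lambda>x. max (h x) (g x))"
    "val t F' \<le> cost t F' (\<lambda>x. min (h x) (g x))"
    by (auto intro: val_le C_min C_max g h)
  ultimately show ?thesis using g h by (simp add: min.commute)
qed

lemma val_shift: "val t (\<lambda>x. f x + c) = val t f"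
proof -
  have *: "val t (\<lambda>x. f x + c) \<le> val t f" for f c
  proof (rule val_greatest)
    fix g assume "g \<in> C"
    then show "val t (\<lambda>x. f x + c) \<le> cost t f g"
      using val_le[OF C_shift, of g t "\<lambda>x. f x + c" c] by (simp add: cost_shift)
  qed
  show ?thesis using *[of f c] *[of "\<lambda>x. f x + c" "- c"] by simp
qed

text \<open>An arbitrary optimal approximation of the next slice stays optimal when it is clamped between
  the two shifts of the approximation of the previous slice.\<close>

lemma optimal_slices:
  fixes F :: "nat \<Rightarrow> 'a \<Rightarrow> real" and l u :: "nat \<Rightarrow> real"
  assumes t: "0 \<le> t"
    and lu: "\<And>a. a \<in> {1..<m} \<Longrightarrow> l a \<le> u a"
    and F: "\<And>a x. a \<in> {1..<m} \<Longrightarrow> x \<in> X \<Longrightarrow> l a \<le> F (Suc a) x - F a x \<and> F (Suc a) x - F a x \<le> u a"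
  shows "\<exists>G. (\<forall>a\<in>{1..m}. G a \<in> C \<and> cost t (F a) (G a) = val t (F a)) \<and>
    (\<forall>a\<in>{1..<m}. \<forall>x\<in>X. l a \<le> G (Suc a) x - G a x \<and> G (Suc a) x - G a x \<le> u a)"
  using lu F
proof (induction m)
  case 0
  then show ?case by auto
next
  case (Suc m)
  have lu: "l a \<le> u a" if "a \<in> {1..m}" for a using Suc.prems(1) that by auto
  have F: "l a \<le> F (Suc a) x - F a x" "F (Suc a) x - F a x \<le> u a" if "a \<in> {1..m}" "x \<in> X" for a x
    using Suc.prems(2)[of a x] that by auto
  have "\<exists>G. (\<forall>a\<in>{1..m}. G a \<in> C \<and> cost t (F a) (G a) = val t (F a)) \<and>
    (\<forall>a\<in>{1..<m}. \<forall>x\<in>X. l a \<le> G (Suc a) x - G a x \<and> G (Suc a) x - G a x \<le> u a)"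
    by (rule Suc.IH) (use lu F in auto)
  then obtain G where G: "\<And>a. a \<in> {1..m} \<Longrightarrow> G a \<in> C \<and> cost t (F a) (G a) = val t (F a)"
    "\<And>a x. a \<in> {1..<m} \<Longrightarrow> x \<in> X \<Longrightarrow> l a \<le> G (Suc a) x - G a x \<and> G (Suc a) x - G a x \<le> u a"
    by blast
  obtain k where k: "k \<in> C" "cost t (F (Suc m)) k = val t (F (Suc m))" using val_attained[OF t] by blast
  show ?case
  proof (cases "m = 0")
    case True
    then show ?thesis using k by (intro exI[of _ "\<lambda>_. k"]) auto
  next
    case False
    then have m: "m \<in> {1..m}" by simp
    define h1 where "h1 x = max (k x) (G m x + l m)" for x
    define h2 where "h2 x = min (h1 x) (G m x + u m)" for x
    have h1: "h1 \<in> C" unfolding h1_def using k G(1)[OF m] by (auto intro: C_max C_shift)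
    have h2: "h2 \<in> C" unfolding h2_def using h1 G(1)[OF m] by (auto intro: C_min C_shift)
    \<comment> \<open>Thus \<open>G m + l m\<close> and \<open>G m + u m\<close> are optimal for
      functions that lie below and above \<open>F (Suc m)\<close>, which is what both uncrossings
      require.\<close>
    have sh: "cost t (\<lambda>x. F m x + c) (\<lambda>x. G m x + c) = val t (\<lambda>x. F m x + c)" for c
      using G(1)[OF m] by (simp add: cost_shift val_shift)
    have Gm: "(\<lambda>x. G m x + c) \<in> C" for c using G(1)[OF m] by (simp add: C_shift)
    have "F m x + l m \<le> F (Suc m) x" if "x \<in> X" for x using F(1)[OF m that] by simp
    from optimal_max[OF this k Gm sh] have "cost t (F (Suc m)) h1 = val t (F (Suc m))"
      unfolding h1_def .
    moreover have "F (Suc m) x \<le> F m x + u m" if "x \<in> X" for x using F(2)[OF m that] by simp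
    ultimately have "cost t (F (Suc m)) h2 = val t (F (Suc m))"
      unfolding h2_def using optimal_min[OF _ h1 _ Gm sh] by blast
    moreover have "l m \<le> h2 x - G m x \<and> h2 x - G m x \<le> u m" for x
      using lu[OF m] by (auto simp: h2_def h1_def)
    ultimately have h2_props: "cost t (F (Suc m)) h2 = val t (F (Suc m))"
      "\<And>x. l m \<le> h2 x - G m x \<and> h2 x - G m x \<le> u m" by auto
    have "(G(Suc m := h2)) a \<in> C \<and> cost t (F a) ((G(Suc m := h2)) a) = val t (F a)"
      if "a \<in> {1..Suc m}" for a
      using that G(1)[of a] h2 h2_props(1) by (cases "a = Suc m") auto
    moreover have "l a \<le> (G(Suc m := h2)) (Suc a) x - (G(Suc m := h2)) a x \<and>
        (G(Suc m := h2)) (Suc a) x - (G(Suc m := h2)) a x \<le> u a"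
      if "a \<in> {1..<Suc m}" "x \<in> X" for a x
      using that G(2)[of a x] h2_props(2)[of x] by (cases "a = m") auto
    ultimately show ?thesis by blast
  qed
qed

end

section \<open>Dimension reduction\<close>

definition bounded_diffs ::
    "nat \<Rightarrow> (nat \<Rightarrow> nat \<Rightarrow> real) \<Rightarrow> (nat \<Rightarrow> nat \<Rightarrow> real) \<Rightarrow> nat set \<Rightarrow> (nat \<Rightarrow> nat) set
      \<Rightarrow> ((nat \<Rightarrow> nat) \<Rightarrow> real) set" where
  "bounded_diffs n l u S X = {f. \<forall>r\<in>S. \<forall>x\<in>X. x r < n \<longrightarrow>
      l r (x r) \<le> f (x(r := x r + 1)) - f x \<and> f (x(r := x r + 1)) - f x \<le> u r (x r)}"

lemma prop_B_eq: "prop_B n d l u = bounded_diffs n l u {1..d} (grid n d)"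
  by (simp add: prop_B_def bounded_diffs_def)

lemma bounded_diffsD:
  assumes "f \<in> bounded_diffs n l u S X" "r \<in> S" "x \<in> X" "x r < n"
  shows "l r (x r) \<le> f (x(r := x r + 1)) - f x" "f (x(r := x r + 1)) - f x \<le> u r (x r)"
  using assms by (auto simp: bounded_diffs_def)

lemma finite_grid: "finite (grid n d)"
  unfolding grid_def by (intro finite_PiE) auto

lemma grid_upd: "x \<in> grid n d \<Longrightarrow> r \<in> {1..d} \<Longrightarrow> a \<in> {1..n} \<Longrightarrow> x(r := a) \<in> grid n d"
  by (auto simp: grid_def PiE_iff extensional_def)

lemma grid_range: "x \<in> grid n d \<Longrightarrow> r \<in> {1..d} \<Longrightarrow> x r \<in> {1..n}"
  by (auto simp: grid_def PiE_iff)

lemma shift_lattice_bounded_diffs: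
  assumes X: "finite X" and S: "finite S" and w: "\<And>x. x \<in> X \<Longrightarrow> 0 \<le> w x"
    and succ: "\<And>r x. r \<in> S \<Longrightarrow> x \<in> X \<Longrightarrow> x r < n \<Longrightarrow> x(r := x r + 1) \<in> X"
    and lu: "\<And>r x. r \<in> S \<Longrightarrow> x \<in> X \<Longrightarrow> x r < n \<Longrightarrow> l r (x r) \<le> u r (x r)"
  shows "shift_lattice X w (bounded_diffs n l u S X)"
proof
  \<comment> \<open>A separable potential all of whose differences equal their lower bounds.\<close>
  have "(\<lambda>x. \<Sum>s\<in>S. \<Sum>a<x s. l s a) \<in> bounded_diffs n l u S X"
    unfolding bounded_diffs_def
  proof (intro CollectI ballI impI)
    fix r x assume r: "r \<in> S" "x \<in> X" "x r < n"
    have "(\<Sum>s\<in>S. \<Sum>a<(x(r := x r + 1)) s. l s a) - (\<Sum>s\<in>S. \<Sum>a<x s. l s a)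
        = (\<Sum>s\<in>S. if s = r then l r (x r) else 0)"
      unfolding sum_subtractf[symmetric] by (intro sum.cong) auto
    also have "\<dots> = l r (x r)" using S r by simp
    finally show "l r (x r) \<le> (\<Sum>s\<in>S. \<Sum>a<(x(r := x r + 1)) s. l s a) - (\<Sum>s\<in>S. \<Sum>a<x s. l s a) \<and>
        (\<Sum>s\<in>S. \<Sum>a<(x(r := x r + 1)) s. l s a) - (\<Sum>s\<in>S. \<Sum>a<x s. l s a) \<le> u r (x r)"
      using lu[OF r] by simp
  qed
  then show "bounded_diffs n l u S X \<noteq> {}" by blast
next
  have "closed {f. x r < n \<longrightarrow>
      l r (x r) \<le> f (x(r := x r + 1)) - f x \<and> f (x(r := x r + 1)) - f x \<le> u r (x r)}" for x r
    by (intro closed_Collect_imp closed_Collect_conj closed_Collect_le open_Collect_const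
        continuous_intros continuous_on_product_coordinates)
  moreover have "bounded_diffs n l u S X = (\<Inter>r\<in>S. \<Inter>x\<in>X. {f. x r < n \<longrightarrow>
      l r (x r) \<le> f (x(r := x r + 1)) - f x \<and> f (x(r := x r + 1)) - f x \<le> u r (x r)})"
    by (auto simp: bounded_diffs_def)
  ultimately show "closed (bounded_diffs n l u S X)" by auto
next
  fix g h assume g: "g \<in> bounded_diffs n l u S X" and h: "\<And>x. x \<in> X \<Longrightarrow> h x = g x"
  show "h \<in> bounded_diffs n l u S X" unfolding bounded_diffs_def
  proof (intro CollectI ballI impI)
    fix r x assume r: "r \<in> S" "x \<in> X" "x r < n"
    show "l r (x r) \<le> h (x(r := x r + 1)) - h x \<and> h (x(r := x r + 1)) - h x \<le> u r (x r)"
      \<comment> \<open>\<open>succ\<close> is needed here because \<open>h\<close> is known to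
        agree with \<open>g\<close> only on \<open>X\<close>.\<close>
      using bounded_diffsD[OF g r] h[OF r(2)] h[OF succ[OF r]] by simp
  qed
next
  fix g h assume g: "g \<in> bounded_diffs n l u S X" and h: "h \<in> bounded_diffs n l u S X"
  show "(\<lambda>x. min (g x) (h x)) \<in> bounded_diffs n l u S X" unfolding bounded_diffs_def
  proof (intro CollectI ballI impI)
    fix r x assume r: "r \<in> S" "x \<in> X" "x r < n"
    show "l r (x r) \<le> min (g (x(r := x r + 1))) (h (x(r := x r + 1))) - min (g x) (h x) \<and>
        min (g (x(r := x r + 1))) (h (x(r := x r + 1))) - min (g x) (h x) \<le> u r (x r)"
      using bounded_diffsD[OF g r] bounded_diffsD[OF h r] by linarith
  qed
  show "(\<lambda>x. max (g x) (h x)) \<in> bounded_diffs n l u S X" unfolding bounded_diffs_def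
  proof (intro CollectI ballI impI)
    fix r x assume r: "r \<in> S" "x \<in> X" "x r < n"
    show "l r (x r) \<le> max (g (x(r := x r + 1))) (h (x(r := x r + 1))) - max (g x) (h x) \<and>
        max (g (x(r := x r + 1))) (h (x(r := x r + 1))) - max (g x) (h x) \<le> u r (x r)"
      using bounded_diffsD[OF g r] bounded_diffsD[OF h r] by linarith
  qed
qed (use X w in \<open>auto simp: bounded_diffs_def\<close>)

text \<open>The points with \<open>y r = 1\<close> represent the lines in direction
  \<open>r\<close>: every grid point is \<open>y(r := a)\<close> for exactly one pair of
  \<open>a\<close> and \<open>y\<close>.\<close>

lemma sum_grid_slices:
  fixes q :: "(nat \<Rightarrow> nat) \<Rightarrow> 'b::comm_monoid_add"
  assumes r: "r \<in> {1..d}" and n: "n \<ge> 1"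
  shows "sum q (grid n d) = (\<Sum>a\<in>{1..n}. \<Sum>y\<in>{y \<in> grid n d. y r = 1}. q (y(r := a)))"
proof -
  have "sum q (grid n d) = sum (\<lambda>(a, y). q (y(r := a))) ({1..n} \<times> {y \<in> grid n d. y r = 1})"
  proof (rule sum.reindex_bij_witness[of _ "\<lambda>(a, y). y(r := a)" "\<lambda>x. (x r, x(r := 1))"])
  qed (use r n grid_upd grid_range in \<open>force simp: fun_upd_idem\<close>)+
  then show ?thesis by (simp add: sum.cartesian_product)
qed

section \<open>Slicing a product weight and adding one dimension at a time\<close>

locale weighted_grid =
  fixes n d :: nat and l u :: "nat \<Rightarrow> nat \<Rightarrow> real" and p :: "nat \<Rightarrow> nat \<Rightarrow> real"
  assumes n: "n \<ge> 1"
    and lu: "\<And>r a. r \<in> {1..d} \<Longrightarrow> a \<in> {1..n-1} \<Longrightarrow> l r a \<le> u r a"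
    and p_nonneg: "\<And>r a. 0 \<le> p r a"
begin

definition weight :: "(nat \<Rightarrow> nat) \<Rightarrow> real" where
  "weight x = (\<Prod>s\<in>{1..d}. p s (x s))"

definition slice_weight :: "nat \<Rightarrow> (nat \<Rightarrow> nat) \<Rightarrow> real" where
  "slice_weight r x = (\<Prod>s\<in>{1..d} - {r}. p s (x s))"

abbreviation slice :: "nat \<Rightarrow> (nat \<Rightarrow> nat) set" where
  "slice r \<equiv> {x \<in> grid n d. x r = 1}"

abbreviation diffs :: "nat set \<Rightarrow> ((nat \<Rightarrow> nat) \<Rightarrow> real) set" where
  "diffs S \<equiv> bounded_diffs n l u S (grid n d)"

abbreviation slice_diffs :: "nat \<Rightarrow> nat set \<Rightarrow> ((nat \<Rightarrow> nat) \<Rightarrow> real) set" where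
  "slice_diffs r S \<equiv> bounded_diffs n l u S (slice r)"

lemma weight_nonneg: "0 \<le> weight x"
  unfolding weight_def by (intro prod_nonneg) (use p_nonneg in auto)

lemma weight_upd: "r \<in> {1..d} \<Longrightarrow> weight (x(r := a)) = p r a * slice_weight r x"
  unfolding weight_def slice_weight_def by (subst prod.remove[of _ r]) auto

lemma grid_succ:
  assumes "x \<in> grid n d" "r \<in> {1..d}" "x r < n"
  shows "x(r := x r + 1) \<in> grid n d" "l r (x r) \<le> u r (x r)"
  using assms grid_range[OF assms(1,2)] lu[OF assms(2), of "x r"] by (auto intro!: grid_upd)

lemma shift_lattice_diffs: "S \<subseteq> {1..d} \<Longrightarrow> shift_lattice (grid n d) weight (diffs S)"
  by (rule shift_lattice_bounded_diffs)
    (use finite_subset[of S "{1..d}"] grid_succ in \<open>auto simp: finite_grid weight_nonneg\<close>)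

text \<open>Since \<open>r\<close> is not in \<open>S\<close>, steps along dimensions in
  \<open>S\<close> stay inside the slice.\<close>

lemma shift_lattice_slice_diffs:
  assumes "S \<subseteq> {1..d}" "r \<notin> S"
  shows "shift_lattice (slice r) (slice_weight r) (slice_diffs r S)"
proof (rule shift_lattice_bounded_diffs)
  show "finite S" using assms(1) by (rule finite_subset) simp
  show "finite (slice r)" by (simp add: finite_grid)
  show "0 \<le> slice_weight r x" for x
    unfolding slice_weight_def by (intro prod_nonneg) (use p_nonneg in auto)
qed (use assms grid_succ in auto)

text \<open>The product form of the weight enters here: up to the factor \<open>p r a\<close>, all
  slices carry the same weight, so they pose one minimisation problem for different targets.\<close>

lemma cost_slices:
  assumes r: "r \<in> {1..d}"
  shows "shift_lattice.cost (grid n d) weight t f g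
    = (\<Sum>a\<in>{1..n}. p r a * shift_lattice.cost (slice r) (slice_weight r) t
        (\<lambda>y. f (y(r := a))) (\<lambda>y. g (y(r := a))))"
proof -
  have "shift_lattice (grid n d) weight (diffs {})" by (rule shift_lattice_diffs) simp
  moreover have "shift_lattice (slice r) (slice_weight r) (slice_diffs r {})"
    by (rule shift_lattice_slice_diffs) auto
  ultimately show ?thesis
    by (simp add: shift_lattice.cost_def sum_grid_slices[OF r n] weight_upd[OF r] sum_distrib_left
        mult.assoc)
qed

text \<open>Constraints in \<open>S\<close> never link two slices, so the slices can be minimised
  separately. As the slices of \<open>f\<close> obey the bounds of dimension \<open>r\<close>,
  \<open>optimal_slices\<close> provides minimisers that obey them too; glued together they are
  feasible for \<open>insert r S\<close> and still attain the slicewise minimum.\<close>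

lemma val_insert_le:
  assumes S: "S \<subseteq> {1..d}" and r: "r \<in> {1..d}" "r \<notin> S" and f: "f \<in> diffs {r}" and t: "0 \<le> t"
  shows "shift_lattice.val (grid n d) weight (diffs (insert r S)) t f
    \<le> shift_lattice.val (grid n d) weight (diffs S) t f"
proof -
  interpret Y: shift_lattice "slice r" "slice_weight r" "slice_diffs r S"
    by (rule shift_lattice_slice_diffs[OF S r(2)])
  interpret A: shift_lattice "grid n d" weight "diffs S"
    by (rule shift_lattice_diffs[OF S])
  interpret B: shift_lattice "grid n d" weight "diffs (insert r S)"
    by (rule shift_lattice_diffs) (use S r in auto)
  define F where "F a y = f (y(r := a))" for a y
  have step: "l r a \<le> F (Suc a) y - F a y \<and> F (Suc a) y - F a y \<le> u r a"
    if a: "a \<in> {1..<n}" and y: "y \<in> slice r" for a y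
  proof -
    have "y(r := a) \<in> grid n d" using y r a by (auto intro: grid_upd)
    from bounded_diffsD[OF f _ this] a show ?thesis by (simp add: F_def)
  qed
  have "l r a \<le> u r a" if "a \<in> {1..<n}" for a
    using lu[OF r(1), of a] that by auto
  from Y.optimal_slices[where F = F and l = "l r" and u = "u r" and m = n, OF t this step]
  obtain G where
    G: "\<And>a. a \<in> {1..n} \<Longrightarrow> G a \<in> slice_diffs r S"
      "\<And>a. a \<in> {1..n} \<Longrightarrow> Y.cost t (F a) (G a) = Y.val t (F a)"
      "\<And>a y. a \<in> {1..<n} \<Longrightarrow> y \<in> slice r \<Longrightarrow> l r a \<le> G (Suc a) y - G a y \<and> G (Suc a) y - G a y \<le> u r a"
    by blast
  \<comment> \<open>Gluing: \<open>x r\<close> selects the slice and \<open>x(r := 1)\<close> the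
    representative within it.\<close>
  define g where "g x = G (x r) (x(r := 1))" for x
  have g: "g \<in> diffs (insert r S)" unfolding bounded_diffs_def
  proof (intro CollectI ballI impI)
    fix s x assume s: "s \<in> insert r S" and x: "x \<in> grid n d" and less: "x s < n"
    have x1: "x(r := 1) \<in> slice r" using grid_upd[OF x r(1), of 1] n by simp
    have xr: "x r \<in> {1..n}" by (rule grid_range[OF x r(1)])
    show "l s (x s) \<le> g (x(s := x s + 1)) - g x \<and> g (x(s := x s + 1)) - g x \<le> u s (x s)"
    proof (cases "s = r")
      case True
      then show ?thesis using G(3)[OF _ x1, of "x r"] xr less by (simp add: g_def)
    next
      case False
      then have "s \<in> S" using s by simp
      from bounded_diffsD[OF G(1)[OF xr] this x1] False less show ?thesis
        by (simp add: g_def fun_upd_twist)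
    qed
  qed
  have cost_g: "A.cost t f g = (\<Sum>a\<in>{1..n}. p r a * Y.val t (F a))"
    unfolding cost_slices[OF r(1)]
  proof (rule sum.cong[OF refl])
    fix a assume a: "a \<in> {1..n}"
    have "Y.cost t (F a) (\<lambda>y. g (y(r := a))) = Y.cost t (F a) (G a)"
      unfolding Y.cost_def by (intro sum.cong) (auto simp: g_def fun_upd_idem)
    then show "p r a * Y.cost t (\<lambda>y. f (y(r := a))) (\<lambda>y. g (y(r := a))) = p r a * Y.val t (F a)"
      unfolding G(2)[OF a] F_def[of a, symmetric] by simp
  qed
  have "B.val t f \<le> A.cost t f g" using g by (rule B.val_le)
  also have "A.cost t f g \<le> A.val t f"
  proof (rule A.val_greatest)
    fix h assume h: "h \<in> diffs S"
    \<comment> \<open>Each slice of a competitor \<open>h\<close> is feasible for the slice problem,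
      so the sum of the slice minima is a lower bound for every \<open>A.cost t f h\<close>.\<close>
    have "Y.val t (F a) \<le> Y.cost t (F a) (\<lambda>y. h (y(r := a)))" if a: "a \<in> {1..n}" for a
    proof (rule Y.val_le, unfold bounded_diffs_def, intro CollectI ballI impI)
      fix s x assume s: "s \<in> S" and x: "x \<in> slice r" and less: "x s < n"
      have "s \<noteq> r" using s r(2) by auto
      have "x(r := a) \<in> grid n d" using x a r by (auto intro: grid_upd)
      from bounded_diffsD[OF h s this] less \<open>s \<noteq> r\<close>
      show "l s (x s) \<le> h (x(s := x s + 1, r := a)) - h (x(r := a)) \<and>
          h (x(s := x s + 1, r := a)) - h (x(r := a)) \<le> u s (x s)"
        by (simp add: fun_upd_twist)
    qed
    then show "A.cost t f g \<le> A.cost t f h"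
      unfolding cost_g cost_slices[OF r(1), of t f h] F_def[symmetric]
      by (intro sum_mono mult_left_mono p_nonneg)
  qed
  finally show ?thesis .
qed

text \<open>Passing from \<open>f\<close> to \<open>h\<close> costs \<open>3 * t\<close> per unit of
  changed weight, and so does going back. For \<open>h\<close> itself the new constraints do not
  increase \<open>val 0\<close>, while shrinking the class cannot decrease \<open>val t\<close>, so
  the gain does not grow.\<close>

lemma gain_insert_le:
  assumes S: "S \<subseteq> {1..d}" and r: "r \<in> {1..d}" "r \<notin> S" and h: "h \<in> diffs {r}" and t: "0 \<le> t"
  shows "shift_lattice.gain (grid n d) weight (diffs (insert r S)) t f
    \<le> shift_lattice.gain (grid n d) weight (diffs S) t f
      + 6 * t * sum weight {x \<in> grid n d. f x \<noteq> h x}"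
proof -
  interpret A: shift_lattice "grid n d" weight "diffs S"
    by (rule shift_lattice_diffs[OF S])
  interpret B: shift_lattice "grid n d" weight "diffs (insert r S)"
    by (rule shift_lattice_diffs) (use S r in auto)
  have "B.gain t f \<le> B.gain t h + 3 * t * sum weight {x \<in> grid n d. f x \<noteq> h x}"
    by (rule B.gain_stable[OF t])
  also have "B.gain t h \<le> A.gain t h"
  proof -
    have "A.val t h \<le> B.val t h"
      by (rule B.val_greatest, rule A.val_le) (auto simp: bounded_diffs_def)
    moreover have "B.val 0 h \<le> A.val 0 h" using S r h by (intro val_insert_le) auto
    ultimately show ?thesis by (simp add: A.gain_def B.gain_def)
  qed
  also have "A.gain t h \<le> A.gain t f + 3 * t * sum weight {x \<in> grid n d. h x \<noteq> f x}"
    by (rule A.gain_stable[OF t])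
  also have "{x \<in> grid n d. h x \<noteq> f x} = {x \<in> grid n d. f x \<noteq> h x}" by auto
  finally show ?thesis by simp
qed

theorem dimension_reduction:
  assumes h: "\<And>r. r \<in> {1..d} \<Longrightarrow> h r \<in> diffs {r}"
  obtains g where "g \<in> prop_B n d l u"
    "sum weight {x \<in> grid n d. f x \<noteq> g x} \<le> 6 * (\<Sum>r\<in>{1..d}. sum weight {x \<in> grid n d. f x \<noteq> h r x})"
proof -
  interpret shift_lattice "grid n d" weight "diffs {1..d}"
    by (rule shift_lattice_diffs) simp
  obtain g t where g: "g \<in> diffs {1..d}" and t: "0 < t"
    and gain: "t * sum weight {x \<in> grid n d. f x \<noteq> g x} \<le> gain t f"
    by (rule ex_gain_ge)
  \<comment> \<open>The threshold \<open>t\<close>, found for the full class, stays fixed while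
    dimensions are added. Without constraints \<open>f\<close> approximates itself, so the gain
    starts at most 0; the factor \<open>t\<close> cancels at the end.\<close>
  have "shift_lattice.gain (grid n d) weight (diffs {1..k}) t f
      \<le> 6 * t * (\<Sum>r\<in>{1..k}. sum weight {x \<in> grid n d. f x \<noteq> h r x})" if "k \<le> d" for k
    using that
  proof (induction k)
    case 0
    interpret Z: shift_lattice "grid n d" weight "diffs {}"
      by (rule shift_lattice_diffs) simp
    have "Z.cost 0 f f = 0" by (simp add: Z.cost_def hinge_zero)
    then have "Z.val 0 f \<le> 0" using Z.val_le[of f 0 f] by (simp add: bounded_diffs_def)
    moreover have "0 \<le> Z.val t f" by (intro Z.val_greatest Z.cost_nonneg)
    ultimately show ?case by (simp add: Z.gain_def)
  next
    case (Suc k)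
    have "shift_lattice.gain (grid n d) weight (diffs (insert (Suc k) {1..k})) t f
      \<le> shift_lattice.gain (grid n d) weight (diffs {1..k}) t f
        + 6 * t * sum weight {x \<in> grid n d. f x \<noteq> h (Suc k) x}"
      using Suc.prems t h by (intro gain_insert_le) auto
    then show ?case using Suc by (simp add: atLeastAtMostSuc_conv algebra_simps)
  qed
  from this[OF order_refl] gain have "t * sum weight {x \<in> grid n d. f x \<noteq> g x}
      \<le> t * (6 * (\<Sum>r\<in>{1..d}. sum weight {x \<in> grid n d. f x \<noteq> h r x}))"
    by (simp add: algebra_simps)
  with t g that show ?thesis by (simp add: prop_B_eq)
qed

end

section \<open>Search trees and one-dimensional repair\<close>

fun ancestors :: "nat tree \<Rightarrow> nat \<Rightarrow> nat list" where
  "ancestors Leaf v = []"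
| "ancestors (Node l a r) v =
     (if v = a then [] else if v < a then a # ancestors l v else a # ancestors r v)"

lemma length_ancestors: "length (ancestors t v) = bst_depth t v"
  by (induction t) auto

lemma set_ancestors: "set (ancestors t v) \<subseteq> set_tree t"
  by (induction t) auto

text \<open>The lowest common ancestor works: it is the first root on the way down that does not
  have both keys strictly on one side. It may be \<open>a\<close> or \<open>b\<close> itself, hence
  the \<open>insert\<close>.\<close>

lemma common_ancestor_between:
  assumes "bst t" "a \<in> set_tree t" "b \<in> set_tree t" "a \<le> b"
  obtains c where "a \<le> c" "c \<le> b" "c \<in> insert a (set (ancestors t a))"
    "c \<in> insert b (set (ancestors t b))"
proof -
  have "\<exists>c. a \<le> c \<and> c \<le> b \<and> c \<in> insert a (set (ancestors t a)) \<and> c \<in> insert b (set (ancestors t b))"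
    using assms
  proof (induction t)
    case (Node t1 c t2)
    consider "b < c" | "c < a" | "a \<le> c" "c \<le> b" by linarith
    then show ?case
    proof cases
      case 1
      then have "a \<in> set_tree t1" "b \<in> set_tree t1" using Node.prems by force+
      with Node 1 show ?thesis by auto
    next
      case 2
      then have "a \<in> set_tree t2" "b \<in> set_tree t2" using Node.prems by force+
      with Node 2 show ?thesis by auto
    next
      case 3
      then show ?thesis by (intro exI[of _ c]) auto
    qed
  qed simp
  with that show ?thesis by blast
qed

lemma bst_depth_le_size: "bst_depth t v \<le> size t"
  by (induction t) auto

lemma size_bst:
  assumes "bst t"
  shows "size t = card (set_tree t)"
proof -
  have "distinct (inorder t)" using assms unfolding bst_iff_sorted_wrt_less strict_sorted_iff by simp
  then show ?thesis using distinct_card[of "inorder t"] by simp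
qed

lemma bsts_on_nonempty: "bsts_on n \<noteq> {}"
proof (induction n)
  case 0
  have "Leaf \<in> bsts_on 0" by (simp add: bsts_on_def)
  then show ?case by blast
next
  case (Suc n)
  then obtain t where "t \<in> bsts_on n" by auto
  then have "bst t" "set_tree t = {1..n}" by (simp_all add: bsts_on_def)
  then have "Node t (Suc n) Leaf \<in> bsts_on (Suc n)"
    unfolding bsts_on_def by (simp add: atLeastAtMostSuc_conv)
  then show ?case by blast
qed

text \<open>The expectation depends only on the depths of \<open>1..n\<close>, each at most the size
  \<open>n\<close> of the tree. So it takes finitely many values and the infimum is a
  minimum.\<close>

lemma Delta_star_1_attained:
  assumes D: "set_pmf D \<subseteq> {1..n}"
  obtains t where "t \<in> bsts_on n"
    "measure_pmf.expectation D (\<lambda>v. real (bst_depth t v)) = Delta_star_1 n D"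
proof -
  let ?E = "\<lambda>t. measure_pmf.expectation D (\<lambda>v. real (bst_depth t v))"
  let ?R = "\<lambda>t. restrict (bst_depth t) {1..n}"
  have E: "?E t = (\<Sum>v\<in>{1..n}. pmf D v * real (?R t v))" for t
    by (subst integral_measure_pmf[of "{1..n}"]) (use D in auto)
  have "?R ` bsts_on n \<subseteq> (\<Pi>\<^sub>E v\<in>{1..n}. {..n})"
  proof (rule image_subsetI)
    fix t assume "t \<in> bsts_on n"
    then have "size t = n" using size_bst[of t] by (auto simp: bsts_on_def)
    then show "?R t \<in> (\<Pi>\<^sub>E v\<in>{1..n}. {..n})" using bst_depth_le_size[of t] by auto
  qed
  then have "finite (?R ` bsts_on n)" by (rule finite_subset) (auto intro: finite_PiE)
  then have "finite ((\<lambda>\<delta>. \<Sum>v\<in>{1..n}. pmf D v * real (\<delta> v)) ` ?R ` bsts_on n)" by simp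
  then have "finite (?E ` bsts_on n)" unfolding image_image E .
  moreover have "?E ` bsts_on n \<noteq> {}" using bsts_on_nonempty by simp
  ultimately have "Inf (?E ` bsts_on n) \<in> ?E ` bsts_on n"
    by (metis Min_in cInf_eq_Min)
  with that show ?thesis unfolding Delta_star_1_def by force
qed

text \<open>The bounds on single steps, summed over the interval between \<open>a\<close> and
  \<open>b\<close>. Stating both orders makes the relation symmetric and forces equal values when
  \<open>a = b\<close>.\<close>

definition compatible ::
    "(nat \<Rightarrow> real) \<Rightarrow> (nat \<Rightarrow> real) \<Rightarrow> nat \<Rightarrow> real \<Rightarrow> nat \<Rightarrow> real \<Rightarrow> bool" where
  "compatible l u a \<alpha> b \<beta> \<longleftrightarrow>
     (a \<le> b \<longrightarrow> sum l {a..<b} \<le> \<beta> - \<alpha> \<and> \<beta> - \<alpha> \<le> sum u {a..<b}) \<and>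
     (b \<le> a \<longrightarrow> sum l {b..<a} \<le> \<alpha> - \<beta> \<and> \<alpha> - \<beta> \<le> sum u {b..<a})"

lemma compatible_refl: "compatible l u a \<alpha> a \<alpha>"
  by (simp add: compatible_def)

lemma compatible_sym: "compatible l u a \<alpha> b \<beta> \<longleftrightarrow> compatible l u b \<beta> a \<alpha>"
  by (auto simp: compatible_def)

text \<open>The bounds on the two halves add up because \<open>c\<close> lies between
  \<open>a\<close> and \<open>b\<close>; this is why the common ancestor has to separate the two
  keys.\<close>

lemma compatible_trans:
  assumes "compatible l u a \<alpha> c \<gamma>" "compatible l u c \<gamma> b \<beta>" "a \<le> c" "c \<le> b"
  shows "compatible l u a \<alpha> b \<beta>"
proof -
  have "sum v {a..<b} = sum v {a..<c} + sum v {c..<b}" for v :: "nat \<Rightarrow> real"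
    using assms(3,4) by (simp add: sum.atLeastLessThan_concat)
  then show ?thesis using assms by (cases "a = b") (auto simp: compatible_def)
qed

lemma compatible_of_bounded_steps:
  assumes step: "\<And>c. c \<in> {1..<n} \<Longrightarrow> l c \<le> f (Suc c) - f c \<and> f (Suc c) - f c \<le> u c"
    and ab: "a \<in> {1..n}" "b \<in> {1..n}"
  shows "compatible l u a (f a) b (f b)"
proof -
  have *: "sum l {a..<b} \<le> f b - f a \<and> f b - f a \<le> sum u {a..<b}"
    if "a \<le> b" "1 \<le> a" "b \<le> n" for a b
  proof -
    have "f b - f a = (\<Sum>c\<in>{a..<b}. f (Suc c) - f c)"
      using that(1) by (simp add: sum_Suc_diff')
    with that step show ?thesis by (auto intro!: sum_mono)
  qed
  show ?thesis using *[of a b] *[of b a] ab by (auto simp: compatible_def)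
qed

text \<open>McShane's extension for the (asymmetric) distance \<open>dist\<close> below, which is additive along the
  line.\<close>

lemma compatible_extension:
  fixes l u f :: "nat \<Rightarrow> real"
  assumes A: "A \<subseteq> {1..n}"
    and lu: "\<And>a. a \<in> {1..<n} \<Longrightarrow> l a \<le> u a"
    and comp: "\<And>a b. a \<in> A \<Longrightarrow> b \<in> A \<Longrightarrow> compatible l u a (f a) b (f b)"
  obtains g where "\<And>a. a \<in> {1..<n} \<Longrightarrow> l a \<le> g (Suc a) - g a \<and> g (Suc a) - g a \<le> u a"
    "\<And>a. a \<in> A \<Longrightarrow> g a = f a"
proof (cases "A = {}")
  case True
  show ?thesis by (rule that[of "\<lambda>a. sum l {..<a}"]) (use lu True in auto)
next
  case False
  have fin: "finite A" using A by (rule finite_subset) simp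
  \<comment> \<open>\<open>dist a b\<close> is the largest value of \<open>g a - g b\<close> that
    the bounds allow.\<close>
  define dist where "dist a b = (if b \<le> a then sum u {b..<a} else - sum l {a..<b})" for a b
  define g where "g a = Min ((\<lambda>b. f b + dist a b) ` A)" for a
  have g_le: "g a \<le> f b + dist a b" if "b \<in> A" for a b
    unfolding g_def using fin that by simp
  have g_eq: "\<exists>b\<in>A. g a = f b + dist a b" for a
  proof -
    have "g a \<in> (\<lambda>b. f b + dist a b) ` A"
      unfolding g_def using fin False by (intro Min_in) auto
    then show ?thesis by blast
  qed
  \<comment> \<open>For every fixed \<open>b\<close> the function \<open>f b + dist a b\<close> of
    \<open>a\<close> obeys the bounds, and a minimum of such functions inherits them.\<close>
  have step: "l a \<le> dist (Suc a) b - dist a b \<and> dist (Suc a) b - dist a b \<le> u a"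
    if "a \<in> {1..<n}" for a b
  proof (cases "b \<le> a")
    case True
    then show ?thesis using lu[OF that] by (simp add: dist_def)
  next
    case False
    then have "sum l {a..<b} = l a + sum l {Suc a..<b}" by (simp add: sum.atLeast_Suc_lessThan)
    then show ?thesis using lu[OF that] False by (auto simp: dist_def le_Suc_eq)
  qed
  show ?thesis
  proof (rule that[of g])
    fix a assume a: "a \<in> {1..<n}"
    obtain b where "b \<in> A" "g a = f b + dist a b" using g_eq by blast
    with g_le[of b "Suc a"] step[OF a, of b] have "g (Suc a) - g a \<le> u a" by simp
    moreover obtain b where "b \<in> A" "g (Suc a) = f b + dist (Suc a) b" using g_eq by blast
    with g_le[of b a] step[OF a, of b] have "l a \<le> g (Suc a) - g a" by simp
    ultimately show "l a \<le> g (Suc a) - g a \<and> g (Suc a) - g a \<le> u a" by simp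
  next
    fix a assume a: "a \<in> A"
    obtain b where "b \<in> A" "g a = f b + dist a b" using g_eq by blast
    with comp[OF a, of b] have "f a \<le> g a" by (auto simp: compatible_def dist_def)
    with g_le[OF a, of a] show "g a = f a" by (simp add: dist_def)
  qed
qed

section \<open>Testing and repairing a single dimension\<close>

definition passes ::
    "(nat \<Rightarrow> nat \<Rightarrow> real) \<Rightarrow> (nat \<Rightarrow> nat \<Rightarrow> real) \<Rightarrow> ((nat \<Rightarrow> nat) \<Rightarrow> real) \<Rightarrow> nat \<Rightarrow> (nat \<Rightarrow> nat) \<Rightarrow> nat \<Rightarrow> bool"
  where "passes l u f r x c \<longleftrightarrow> compatible (l r) (u r) (x r) (f x) c (f (x(r := c)))"

lemma passes_prop_B:
  assumes f: "f \<in> prop_B n d l u" and x: "x \<in> grid n d" "r \<in> {1..d}" "c \<in> {1..n}"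
  shows "passes l u f r x c"
proof -
  have "compatible (l r) (u r) (x r) (f (x(r := x r))) c (f (x(r := c)))"
  proof (rule compatible_of_bounded_steps)
    fix a assume a: "a \<in> {1..<n}"
    then have "x(r := a) \<in> grid n d" using x by (auto intro: grid_upd)
    with a bounded_diffsD[OF f[unfolded prop_B_eq] x(2) this]
    show "l r a \<le> f (x(r := Suc a)) - f (x(r := a)) \<and> f (x(r := Suc a)) - f (x(r := a)) \<le> u r a"
      by simp
  qed (use x grid_range in auto)
  then show ?thesis by (simp add: passes_def)
qed

lemma repair_dimension:
  assumes n: "n \<ge> 1" and r: "r \<in> {1..d}" and t: "t \<in> bsts_on n"
    and lu: "\<And>a. a \<in> {1..<n} \<Longrightarrow> l r a \<le> u r a"
  obtains h where "h \<in> bounded_diffs n l u {r} (grid n d)"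
    "{x \<in> grid n d. f x \<noteq> h x} \<subseteq> {x \<in> grid n d. \<exists>c\<in>set (ancestors t (x r)). \<not> passes l u f r x c}"
proof -
  define A where
    "A y = {a \<in> {1..n}. \<forall>c\<in>set (ancestors t a). passes l u f r (y(r := a)) c}" for y
  have "\<exists>g. (\<forall>a\<in>{1..<n}. l r a \<le> g (Suc a) - g a \<and> g (Suc a) - g a \<le> u r a) \<and>
      (\<forall>a\<in>A y. g a = f (y(r := a)))" for y
  proof -
    \<comment> \<open>The ancestor \<open>c\<close> is compared through its value under
      \<open>f\<close>; it may itself be outside \<open>A y\<close>.\<close>
    have anc: "compatible (l r) (u r) a (f (y(r := a))) c (f (y(r := c)))"
      if "a \<in> A y" "c \<in> insert a (set (ancestors t a))" for a c
      using that by (auto simp: A_def passes_def compatible_refl)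
    have le: "compatible (l r) (u r) a (f (y(r := a))) b (f (y(r := b)))"
      if "a \<in> A y" "b \<in> A y" "a \<le> b" for a b
    proof -
      have t': "bst t" "a \<in> set_tree t" "b \<in> set_tree t"
        using t that by (auto simp: bsts_on_def A_def)
      obtain c where "a \<le> c" "c \<le> b" and c: "c \<in> insert a (set (ancestors t a))"
        "c \<in> insert b (set (ancestors t b))"
        by (rule common_ancestor_between[OF t' \<open>a \<le> b\<close>])
      moreover note anc[OF that(1) c(1)]
      moreover have "compatible (l r) (u r) c (f (y(r := c))) b (f (y(r := b)))"
        using anc[OF that(2) c(2)] by (simp only: compatible_sym)
      ultimately show ?thesis using compatible_trans by blast
    qed
    have all: "compatible (l r) (u r) a (f (y(r := a))) b (f (y(r := b)))"
      if "a \<in> A y" "b \<in> A y" for a b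
    proof (cases "a \<le> b")
      case False
      then show ?thesis using le[OF that(2,1)] by (subst compatible_sym) simp
    qed (rule le[OF that])
    have "A y \<subseteq> {1..n}" by (auto simp: A_def)
    then show ?thesis
    proof (rule compatible_extension[where l = "l r" and u = "u r" and f = "\<lambda>a. f (y(r := a))",
          OF _ lu all])
      fix g assume "\<And>a. a \<in> {1..<n} \<Longrightarrow> l r a \<le> g (Suc a) - g a \<and> g (Suc a) - g a \<le> u r a"
        "\<And>a. a \<in> A y \<Longrightarrow> g a = f (y(r := a))"
      then show ?thesis by blast
    qed
  qed
  then have "\<exists>g. \<forall>y. (\<forall>a\<in>{1..<n}. l r a \<le> g y (Suc a) - g y a \<and> g y (Suc a) - g y a \<le> u r a) \<and>
      (\<forall>a\<in>A y. g y a = f (y(r := a)))"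
    by (intro choice allI)
  then obtain g where g: "\<And>y a. a \<in> {1..<n} \<Longrightarrow> l r a \<le> g y (Suc a) - g y a \<and> g y (Suc a) - g y a \<le> u r a"
    "\<And>y a. a \<in> A y \<Longrightarrow> g y a = f (y(r := a))" by blast
  \<comment> \<open>Resetting coordinate \<open>r\<close> to 1 names the line through
    \<open>x\<close>, so all its points use the same extension.\<close>
  define h where "h x = g (x(r := 1)) (x r)" for x
  show ?thesis
  proof (rule that[of h])
    show "h \<in> bounded_diffs n l u {r} (grid n d)"
      using g(1) grid_range[OF _ r] by (auto simp: bounded_diffs_def h_def)
    show "{x \<in> grid n d. f x \<noteq> h x}
        \<subseteq> {x \<in> grid n d. \<exists>c\<in>set (ancestors t (x r)). \<not> passes l u f r x c}"
    proof safe
      fix x assume x: "x \<in> grid n d" and ne: "f x \<noteq> h x"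
      show "\<exists>c\<in>set (ancestors t (x r)). \<not> passes l u f r x c"
      proof (rule ccontr)
        assume "\<not> ?thesis"
        then have "x r \<in> A (x(r := 1))" using grid_range[OF x r] by (simp add: A_def)
        from g(2)[OF this] ne show False by (simp add: h_def)
      qed
    qed
  qed
qed

section \<open>The tester\<close>

lemma ex_pmf_proportional:
  fixes q :: "'a \<Rightarrow> real"
  assumes A: "finite A" and q: "\<And>x. x \<in> A \<Longrightarrow> 0 \<le> q x" and pos: "0 < sum q A"
  obtains P where "set_pmf P \<subseteq> A"
    "\<And>B. measure_pmf.prob P B = sum q (A \<inter> B) / sum q A"
proof -
  define m where "m x = (if x \<in> A then q x / sum q A else 0)" for x
  have nonneg: "0 \<le> m x" for x using q pos by (simp add: m_def)
  have "(\<integral>\<^sup>+x. ennreal (m x) \<partial>count_space UNIV) = (\<Sum>x\<in>A. ennreal (m x))"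
    by (rule nn_integral_count_space'[OF A]) (auto simp: m_def)
  also have "\<dots> = ennreal (\<Sum>x\<in>A. m x)" using nonneg by (intro sum_ennreal) auto
  also have "(\<Sum>x\<in>A. m x) = 1" using pos by (simp add: m_def sum_divide_distrib[symmetric])
  finally have one: "(\<integral>\<^sup>+x. ennreal (m x) \<partial>count_space UNIV) = 1" by simp
  have pmf: "pmf (embed_pmf m) x = m x" for x by (rule pmf_embed_pmf[OF nonneg one])
  have set: "set_pmf (embed_pmf m) \<subseteq> A"
    by (auto simp: set_pmf_eq pmf m_def)
  have "measure_pmf.prob (embed_pmf m) B = sum q (A \<inter> B) / sum q A" for B
  proof -
    have "measure_pmf.prob (embed_pmf m) B = measure_pmf.prob (embed_pmf m) (A \<inter> B)"
      by (rule measure_pmf.finite_measure_eq_AE) (use set in \<open>auto simp: AE_measure_pmf_iff\<close>)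
    also have "\<dots> = sum m (A \<inter> B)" using A by (simp add: measure_measure_pmf_finite pmf)
    also have "\<dots> = sum q (A \<inter> B) / sum q A" by (simp add: m_def sum_divide_distrib)
    finally show ?thesis .
  qed
  with set that show ?thesis by blast
qed

text \<open>A query rule that looks only at the number of previous answers is nonadaptive.\<close>

lemma answers_nonadaptive: "answers (\<lambda>as. pt (length as)) f q = map (\<lambda>j. f (pt j)) [0..<q]"
  by (induction q) (auto simp: Let_def)

section \<open>The product distribution as a weight on the grid\<close>

locale product_grid =
  fixes n d :: nat and l u :: "nat \<Rightarrow> nat \<Rightarrow> real" and Dr :: "nat \<Rightarrow> nat pmf"
  assumes n: "n \<ge> 1"
    and bounding: "bounding_family n d l u"
    and support: "\<forall>r\<in>{1..d}. set_pmf (Dr r) \<subseteq> {1..n}"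
begin

sublocale weighted_grid n d l u "\<lambda>r. pmf (Dr r)"
  using n bounding by unfold_locales (auto simp: bounding_family_def less_imp_le)

lemma pmf_prod_dist: "x \<in> grid n d \<Longrightarrow> pmf (prod_dist d Dr) x = weight x"
  unfolding prod_dist_def weight_def
  by (subst pmf_Pi) (auto simp: grid_def PiE_iff extensional_def)

text \<open>Outside \<open>{1..d}\<close> the product distribution has the default
  \<open>undefined\<close>, the value that extensional functions take there.\<close>

lemma set_prod_dist: "set_pmf (prod_dist d Dr) \<subseteq> grid n d"
proof
  fix x assume "x \<in> set_pmf (prod_dist d Dr)"
  then have "x \<in> PiE_dflt {1..d} undefined (\<lambda>r. set_pmf (Dr r))"
    by (simp add: prod_dist_def set_Pi_pmf o_def)
  then have x: "r \<in> {1..d} \<Longrightarrow> x r \<in> set_pmf (Dr r)" and x': "r \<notin> {1..d} \<Longrightarrow> x r = undefined" for r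
    unfolding PiE_dflt_def by auto
  show "x \<in> grid n d" unfolding grid_def
  proof (rule PiE_I)
    fix r assume "r \<in> {1..d}"
    with x[OF this] support show "x r \<in> {1..n}" by blast
  qed (rule x')
qed

lemma prob_prod_dist: "measure_pmf.prob (prod_dist d Dr) B = sum weight {x \<in> grid n d. x \<in> B}"
proof -
  have "measure_pmf.prob (prod_dist d Dr) B
      = measure_pmf.prob (prod_dist d Dr) {x \<in> grid n d. x \<in> B}"
    by (rule measure_pmf.finite_measure_eq_AE) (use set_prod_dist in \<open>auto simp: AE_measure_pmf_iff\<close>)
  also have "\<dots> = sum weight {x \<in> grid n d. x \<in> B}"
    by (subst measure_measure_pmf_finite) (auto simp: finite_grid pmf_prod_dist)
  finally show ?thesis .
qed

lemma sum_weight_coordinate: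
  assumes r: "r \<in> {1..d}"
  shows "(\<Sum>x\<in>grid n d. weight x * h (x r)) = measure_pmf.expectation (Dr r) h"
proof -
  have "Dr r = map_pmf (\<lambda>x. x r) (prod_dist d Dr)"
    unfolding prod_dist_def using r by (simp add: Pi_pmf_component)
  then have "measure_pmf.expectation (Dr r) h
      = measure_pmf.expectation (prod_dist d Dr) (\<lambda>x. h (x r))" by (metis integral_map_pmf)
  also have "\<dots> = (\<Sum>x\<in>grid n d. pmf (prod_dist d Dr) x * h (x r))"
    by (subst integral_measure_pmf[OF finite_grid[of n d]]) (use set_prod_dist in auto)
  finally show ?thesis by (simp add: pmf_prod_dist)
qed

lemma distD_set_le:
  assumes "g \<in> prop_B n d l u"
  shows "distD_set (prod_dist d Dr) f (prop_B n d l u) \<le> sum weight {x \<in> grid n d. f x \<noteq> g x}"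
proof -
  have "distD_set (prod_dist d Dr) f (prop_B n d l u) \<le> distD (prod_dist d Dr) f g"
    unfolding distD_set_def using assms
    by (intro cINF_lower) (auto intro!: bdd_belowI[of _ 0] simp: distD_def)
  then show ?thesis by (simp add: distD_def prob_prod_dist)
qed

end

section \<open>Sampling tests from optimal trees\<close>

locale bst_tester = product_grid +
  fixes T :: "nat \<Rightarrow> nat tree"
  assumes T: "\<And>r. r \<in> {1..d} \<Longrightarrow> T r \<in> bsts_on n"
    and optimal: "\<And>r. r \<in> {1..d} \<Longrightarrow>
      measure_pmf.expectation (Dr r) (\<lambda>v. real (bst_depth (T r) v)) = Delta_star_1 n (Dr r)"
begin

text \<open>A sample \<open>(r, x, i)\<close> stands for the pair of \<open>x\<close> and the point obtained from \<open>x\<close> by moving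
  along dimension \<open>r\<close> to the \<open>i\<close>-th proper ancestor of \<open>x r\<close> in \<open>T r\<close>.\<close>

definition samples :: "(nat \<times> (nat \<Rightarrow> nat) \<times> nat) set" where
  "samples = (SIGMA r:{1..d}. SIGMA x:grid n d. {..<bst_depth (T r) (x r)})"

definition sample_weight :: "nat \<times> (nat \<Rightarrow> nat) \<times> nat \<Rightarrow> real" where
  "sample_weight = (\<lambda>(r, x, i). weight x)"

definition pivot :: "nat \<times> (nat \<Rightarrow> nat) \<times> nat \<Rightarrow> nat" where
  "pivot = (\<lambda>(r, x, i). ancestors (T r) (x r) ! i)"

definition sample_passes :: "((nat \<Rightarrow> nat) \<Rightarrow> real) \<Rightarrow> nat \<times> (nat \<Rightarrow> nat) \<times> nat \<Rightarrow> bool" where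
  "sample_passes f = (\<lambda>(r, x, i). passes l u f r x (pivot (r, x, i)))"

lemma sample_weight_nonneg: "0 \<le> sample_weight e"
  by (cases e) (simp add: sample_weight_def weight_nonneg)

lemma finite_samples: "finite samples"
  unfolding samples_def by (intro finite_SigmaI) (auto simp: finite_grid)

lemma sum_samples:
  "sum q samples = (\<Sum>r\<in>{1..d}. \<Sum>x\<in>grid n d. \<Sum>i<bst_depth (T r) (x r). q (r, x, i))"
  unfolding samples_def
  by (simp add: sum.Sigma finite_grid split_def)

text \<open>Each \<open>x\<close> is counted once per proper ancestor, so every dimension
  contributes its expected depth. The total is the normalising constant of the test
  distribution.\<close>

lemma sum_sample_weight: "sum sample_weight samples = Delta_star n d Dr"
proof -
  have "sum sample_weight samples
      = (\<Sum>r\<in>{1..d}. \<Sum>x\<in>grid n d. weight x * real (bst_depth (T r) (x r)))"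
    by (simp add: sum_samples sample_weight_def mult.commute)
  also have "\<dots> = Delta_star n d Dr" unfolding Delta_star_def
  proof (rule sum.cong[OF refl])
    fix r assume r: "r \<in> {1..d}"
    show "(\<Sum>x\<in>grid n d. weight x * real (bst_depth (T r) (x r))) = Delta_star_1 n (Dr r)"
      using sum_weight_coordinate[OF r, of "\<lambda>v. real (bst_depth (T r) v)"] optimal[OF r] by simp
  qed
  finally show ?thesis .
qed

lemma pivot_range:
  assumes "(r, x, i) \<in> samples"
  shows "r \<in> {1..d}" "x \<in> grid n d" "pivot (r, x, i) \<in> {1..n}"
proof -
  show r: "r \<in> {1..d}" and "x \<in> grid n d" using assms by (auto simp: samples_def)
  have "pivot (r, x, i) \<in> set (ancestors (T r) (x r))"
    using assms by (auto simp: samples_def pivot_def length_ancestors)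
  also have "\<dots> \<subseteq> {1..n}" using set_ancestors T[OF r] by (auto simp: bsts_on_def)
  finally show "pivot (r, x, i) \<in> {1..n}" .
qed

text \<open>Repairing every dimension separately changes only points that fail against some
  ancestor. \<open>dimension_reduction\<close> combines the repairs at the price of the factor
  6.\<close>

lemma distD_set_le_failing:
  "distD_set (prod_dist d Dr) f (prop_B n d l u)
    \<le> 6 * sum sample_weight (samples \<inter> {e. \<not> sample_passes f e})"
proof -
  let ?bad = "\<lambda>r. {x \<in> grid n d. \<exists>c\<in>set (ancestors (T r) (x r)). \<not> passes l u f r x c}"
  have "\<exists>h. h \<in> diffs {r} \<and> {x \<in> grid n d. f x \<noteq> h x} \<subseteq> ?bad r" if r: "r \<in> {1..d}" for r
  proof -
    have "l r a \<le> u r a" if "a \<in> {1..<n}" for a by (rule lu[OF r]) (use that in auto)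
    then obtain h where "h \<in> diffs {r}" "{x \<in> grid n d. f x \<noteq> h x} \<subseteq> ?bad r"
      by (rule repair_dimension[where l = l and u = u and f = f, OF n r T[OF r]])
    then show ?thesis by blast
  qed
  then have "\<exists>h. \<forall>r\<in>{1..d}. h r \<in> diffs {r} \<and> {x \<in> grid n d. f x \<noteq> h r x} \<subseteq> ?bad r"
    by (intro bchoice ballI)
  then obtain h where h: "\<And>r. r \<in> {1..d} \<Longrightarrow> h r \<in> diffs {r}"
    "\<And>r. r \<in> {1..d} \<Longrightarrow> {x \<in> grid n d. f x \<noteq> h r x} \<subseteq> ?bad r" by blast
  obtain g where g: "g \<in> prop_B n d l u"
    "sum weight {x \<in> grid n d. f x \<noteq> g x} \<le> 6 * (\<Sum>r\<in>{1..d}. sum weight {x \<in> grid n d. f x \<noteq> h r x})"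
    using dimension_reduction[of h f] h(1) by blast
  have "(\<Sum>r\<in>{1..d}. sum weight {x \<in> grid n d. f x \<noteq> h r x}) \<le> (\<Sum>r\<in>{1..d}. sum weight (?bad r))"
    by (intro sum_mono sum_mono2 h(2)) (auto simp: finite_grid weight_nonneg)
  also have "\<dots> = (\<Sum>r\<in>{1..d}. \<Sum>x\<in>grid n d. if x \<in> ?bad r then weight x else 0)"
    by (rule sum.cong[OF refl], subst sum.inter_filter[OF finite_grid, symmetric], rule sum.cong) auto
  \<comment> \<open>A bad point is charged to one failing sample \<open>(r, x, i)\<close>, which has
    the same weight.\<close>
  also have "\<dots> \<le> (\<Sum>r\<in>{1..d}. \<Sum>x\<in>grid n d. \<Sum>i<bst_depth (T r) (x r).
      if \<not> sample_passes f (r, x, i) then weight x else 0)"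
  proof (intro sum_mono)
    fix r x assume "x \<in> grid n d"
    show "(if x \<in> ?bad r then weight x else 0) \<le> (\<Sum>i<bst_depth (T r) (x r).
      if \<not> sample_passes f (r, x, i) then weight x else 0)"
    proof (cases "x \<in> ?bad r")
      case True
      then obtain i where i: "i < bst_depth (T r) (x r)" "\<not> sample_passes f (r, x, i)"
        by (auto simp: in_set_conv_nth length_ancestors sample_passes_def pivot_def)
      have "(if \<not> sample_passes f (r, x, i) then weight x else 0) \<le> (\<Sum>i<bst_depth (T r) (x r).
          if \<not> sample_passes f (r, x, i) then weight x else 0)"
        by (rule member_le_sum) (use i weight_nonneg in auto)
      with i True show ?thesis by simp
    qed (auto intro!: sum_nonneg simp: weight_nonneg)
  qed
  also have "\<dots> = (\<Sum>e\<in>samples. if \<not> sample_passes f e then sample_weight e else 0)"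
    unfolding sum_samples sample_weight_def prod.case ..
  also have "\<dots> = sum sample_weight (samples \<inter> {e. \<not> sample_passes f e})"
    by (simp add: sum.inter_restrict[OF finite_samples])
  finally show ?thesis using g(2) distD_set_le[OF g(1), of f] by linarith
qed

text \<open>Queries \<open>2 * j\<close> and \<open>2 * j + 1\<close> serve test \<open>j\<close>.
  Beyond the last test the all-ones point is used, because \<open>is_tester\<close> requires the
  query function to stay in the grid on answer lists of every length.\<close>

definition query :: "nat \<Rightarrow> (nat \<Rightarrow> nat \<times> (nat \<Rightarrow> nat) \<times> nat) \<Rightarrow> nat \<Rightarrow> (nat \<Rightarrow> nat)" where
  "query k es j = (if j < 2 * k then (case es (j div 2) of (r, x, i) \<Rightarrow>
      if even j then x else x(r := pivot (r, x, i))) else restrict (\<lambda>_. 1) {1..d})"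

definition verdict :: "nat \<Rightarrow> (nat \<Rightarrow> nat \<times> (nat \<Rightarrow> nat) \<times> nat) \<Rightarrow> real list \<Rightarrow> bool" where
  "verdict k es as \<longleftrightarrow> (\<forall>j<k. case es j of (r, x, i) \<Rightarrow>
      compatible (l r) (u r) (x r) (as ! (2 * j)) (pivot (r, x, i)) (as ! (2 * j + 1)))"

definition alg :: "nat \<Rightarrow> (nat \<Rightarrow> nat \<times> (nat \<Rightarrow> nat) \<times> nat) \<Rightarrow> query_alg" where
  "alg k es = (\<lambda>as. query k es (length as), verdict k es)"

lemma query_grid:
  assumes "\<And>j. j < k \<Longrightarrow> es j \<in> samples"
  shows "query k es j \<in> grid n d"
proof (cases "j < 2 * k")
  case True
  obtain r x i where e: "es (j div 2) = (r, x, i)" by (metis prod_cases3)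
  have "(r, x, i) \<in> samples" using assms[of "j div 2"] True e by simp
  from pivot_range[OF this] e True show ?thesis by (auto simp: query_def intro: grid_upd)
qed (use n in \<open>auto simp: query_def grid_def\<close>)

lemma run_alg_iff: "run_alg (alg k es) (2 * k) f \<longleftrightarrow> (\<forall>j<k. sample_passes f (es j))"
proof -
  have "(case es j of (r, x, i) \<Rightarrow>
      compatible (l r) (u r) (x r) (map (\<lambda>j. f (query k es j)) [0..<2 * k] ! (2 * j))
        (pivot (r, x, i)) (map (\<lambda>j. f (query k es j)) [0..<2 * k] ! (2 * j + 1)))
      \<longleftrightarrow> sample_passes f (es j)" if "j < k" for j
    using that by (auto simp: sample_passes_def passes_def query_def split: prod.splits)
  then show ?thesis by (simp add: run_alg_def alg_def answers_nonadaptive verdict_def)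
qed

theorem ex_tester:
  assumes \<epsilon>: "\<epsilon> > 0"
  shows "\<exists>A q. is_tester n d (prop_B n d l u) (prod_dist d Dr) \<epsilon> A q \<and>
    real q \<le> 36 * Delta_star n d Dr / \<epsilon>"
\<comment> \<open>If \<open>6 * Delta_star n d Dr <= \<epsilon>\<close>, no function is far and
  accepting without queries is correct. Otherwise the extra test due to rounding up is absorbed in
  the query bound.\<close>
proof (cases "6 * Delta_star n d Dr \<le> \<epsilon>")
  case True
  have "distD_set (prod_dist d Dr) f (prop_B n d l u) \<le> \<epsilon>" for f
  proof -
    have "sum sample_weight (samples \<inter> {e. \<not> sample_passes f e}) \<le> sum sample_weight samples"
      by (intro sum_mono2 finite_samples sample_weight_nonneg) auto
    with distD_set_le_failing[of f] True sum_sample_weight show ?thesis by linarith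
  qed
  then have far: "\<not> \<epsilon> < distD_set (prod_dist d Dr) f (prop_B n d l u)" for f
    by (simp add: not_less)
  have "0 \<le> Delta_star n d Dr" unfolding sum_sample_weight[symmetric] by (intro sum_nonneg sample_weight_nonneg)
  moreover have "is_tester n d (prop_B n d l u) (prod_dist d Dr) \<epsilon>
      (return_pmf (alg 0 (\<lambda>_. undefined))) 0"
    using far query_grid[of 0] run_alg_iff[of 0]
    by (simp add: is_tester_def accept_prob_def alg_def)
  ultimately show ?thesis using \<epsilon> by (intro exI conjI) auto
next
  case False
  define \<Delta> where "\<Delta> = Delta_star n d Dr"
  have \<Delta>: "\<epsilon> < 6 * \<Delta>" "0 < \<Delta>" using False \<epsilon> by (simp_all add: \<Delta>_def)
  \<comment> \<open>On a far function one test fails with probability more than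
    \<open>\<epsilon> / (6 * \<Delta>)\<close>, so this many tests push the acceptance probability
    down to at most \<open>exp (- 2)\<close>.\<close>
  define k where "k = nat \<lceil>12 * \<Delta> / \<epsilon>\<rceil>"
  have k: "12 * \<Delta> / \<epsilon> \<le> real k" "real k \<le> 12 * \<Delta> / \<epsilon> + 1"
    using \<Delta> \<epsilon> by (simp_all add: k_def real_nat_ceiling_ge of_nat_ceiling)
  obtain P where P: "set_pmf P \<subseteq> samples"
    "\<And>B. measure_pmf.prob P B = sum sample_weight (samples \<inter> B) / \<Delta>"
    using ex_pmf_proportional[of samples sample_weight, OF finite_samples sample_weight_nonneg] \<Delta>
    unfolding sum_sample_weight \<Delta>_def by blast
  define R where "R = Pi_pmf {..<k} undefined (\<lambda>_. P)"
  define A where "A = map_pmf (alg k) R"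
  have R: "es j \<in> samples" if "es \<in> set_pmf R" "j < k" for es j
    using that P(1) by (auto simp: R_def set_Pi_pmf PiE_dflt_def)
  have accept: "accept_prob A (2 * k) f = measure_pmf.prob P {e. sample_passes f e} ^ k" for f
  proof -
    \<comment> \<open>Acceptance means that all \<open>k\<close> independent samples pass, which
      yields a power.\<close>
    have "accept_prob A (2 * k) f = measure_pmf.prob R (Pi {..<k} (\<lambda>_. {e. sample_passes f e}))"
      unfolding accept_prob_def A_def measure_map_pmf
      by (rule arg_cong[where f = "measure_pmf.prob R"]) (auto simp: run_alg_iff Pi_iff)
    then show ?thesis unfolding R_def by (simp add: measure_Pi_pmf_Pi)
  qed
  have "is_tester n d (prop_B n d l u) (prod_dist d Dr) \<epsilon> A (2 * k)"
    unfolding is_tester_def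
  proof (intro conjI ballI allI impI)
    fix B as assume "B \<in> set_pmf A"
    then show "fst B as \<in> grid n d" using R query_grid by (auto simp: A_def alg_def)
  next
    fix f assume f: "f \<in> prop_B n d l u"
    have "sample_passes f e" if "e \<in> samples" for e
      using pivot_range passes_prop_B[OF f] that by (cases e) (auto simp: sample_passes_def)
    then have "measure_pmf.prob P {e. sample_passes f e} = 1"
      using P(1) by (subst measure_pmf.prob_eq_1) (auto simp: AE_measure_pmf_iff)
    then show "2 / 3 < accept_prob A (2 * k) f" by (simp add: accept)
  next
    fix f assume far: "\<epsilon> < distD_set (prod_dist d Dr) f (prop_B n d l u)"
    have "measure_pmf.prob P {e. sample_passes f e} = 1 - measure_pmf.prob P {e. \<not> sample_passes f e}"
      using measure_pmf.prob_compl[of "{e. \<not> sample_passes f e}" P]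
      by (simp add: Compl_eq_Diff_UNIV[symmetric] Collect_neg_eq[symmetric])
    also have "\<dots> \<le> 1 - \<epsilon> / (6 * \<Delta>)"
      unfolding P(2) using distD_set_le_failing[of f] far \<Delta> by (simp add: field_simps)
    also have "\<dots> \<le> exp (- (\<epsilon> / (6 * \<Delta>)))" using exp_ge_add_one_self[of "- (\<epsilon> / (6 * \<Delta>))"] by simp
    finally have "accept_prob A (2 * k) f \<le> exp (- (\<epsilon> / (6 * \<Delta>))) ^ k"
      unfolding accept by (intro power_mono) auto
    also have "\<dots> = exp (- (real k * (\<epsilon> / (6 * \<Delta>))))" by (simp add: exp_of_nat_mult[symmetric])
    also have "\<dots> \<le> exp (- 2)" using k(1) \<Delta> \<epsilon> by (simp add: field_simps)
    \<comment> \<open>The quadratic Taylor bound gives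
      \<open>exp 2 >= 1 + 2 + 2 = 5\<close>.\<close>
    also have "\<dots> < 1 / 3"
      using exp_lower_Taylor_quadratic[of 2] by (simp add: exp_minus field_simps)
    finally show "2 / 3 < 1 - accept_prob A (2 * k) f" by simp
  qed
  \<comment> \<open>Two queries per test give at most \<open>24 * \<Delta> / \<epsilon> + 2\<close>,
    and \<open>2 < 12 * \<Delta> / \<epsilon>\<close> in this case.\<close>
  moreover have "real (2 * k) \<le> 36 * \<Delta> / \<epsilon>"
    using k(2) \<Delta> \<epsilon> by (simp add: field_simps)
  ultimately show ?thesis unfolding \<Delta>_def by blast
qed

end

theorem theorem1p3:
  fixes n d :: nat and l u :: "nat \<Rightarrow> nat \<Rightarrow> real" and Dr :: "nat \<Rightarrow> nat pmf" and \<epsilon> :: real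
  assumes "n \<ge> 1" and "d \<ge> 1"
    and "bounding_family n d l u"
    and "\<forall>r\<in>{1..d}. set_pmf (Dr r) \<subseteq> {1..n}"
    and "\<epsilon> > 0"
  shows "\<exists>T q. is_tester n d (prop_B n d l u) (prod_dist d Dr) \<epsilon> T q \<and>
           real q \<le> 100 * Delta_star n d Dr / \<epsilon>"
proof -
  have "\<exists>t. t \<in> bsts_on n \<and>
      measure_pmf.expectation (Dr r) (\<lambda>v. real (bst_depth t v)) = Delta_star_1 n (Dr r)"
    if "r \<in> {1..d}" for r
    using Delta_star_1_attained[of "Dr r" n] assms(4) that by metis
  then obtain t where "\<And>r. r \<in> {1..d} \<Longrightarrow> t r \<in> bsts_on n \<and>
      measure_pmf.expectation (Dr r) (\<lambda>v. real (bst_depth (t r) v)) = Delta_star_1 n (Dr r)"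
    by metis
  then interpret bst_tester n d l u Dr t
    using assms by unfold_locales auto
  obtain A q where A: "is_tester n d (prop_B n d l u) (prod_dist d Dr) \<epsilon> A q"
    and q: "real q \<le> 36 * Delta_star n d Dr / \<epsilon>" using ex_tester[OF assms(5)] by blast
  \<comment> \<open>Nonnegativity, read off from the query count, permits weakening 36 to
    100.\<close>
  have "0 \<le> Delta_star n d Dr / \<epsilon>"
    using order_trans[OF of_nat_0_le_iff q] by simp
  with A q show ?thesis by (intro exI[of _ A] exI[of _ q]) auto
qed

end
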